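(* Let $n\ge 1$ be an integer. If $\{H_1,\dots,H_m\}$ is a set of $m$ mutually unbiased Bush-type Hadamard matrices of order $4n^2$, then $m\le 2n-1$.
   Context: $J_k$ denotes the all-ones matrix of order $k$. A Hadamard matrix of order $k$ is a $k\times k$ matrix with entries in $\{-1,1\}$ and pairwise orthogonal rows. Two Hadamard matrices $H,K$ of order $k$ are unbiased if $HK^t=\sqrt{k}\,L$ for some Hadamard matrix $L$; a set of Hadamard matrices is mutually unbiased if any two distinct members are unbiased. A Bush-type Hadamard matrix of order $4n^2$ is a Hadamard matrix $H=[H_{ij}]_{1\le i,j\le 2n}$ of order $4n^2$, partitioned into $2n\times 2n$ blocks $H_{ij}$, such that $H_{ii}=J_{2n}$ for all $i$ and $H_{ij}J_{2n}=J_{2n}H_{ij}=0$ for all $i\neq j$. *)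

theory Defs
  imports Complex_Main "Jordan_Normal_Form.Matrix"
begin

definition all_ones_mat :: "nat \<Rightarrow> real mat" where
  "all_ones_mat k = mat k k (\<lambda>_. 1)"

definition hadamard :: "nat \<Rightarrow> real mat \<Rightarrow> bool" where
  "hadamard k H \<longleftrightarrow>
     H \<in> carrier_mat k k \<and>
     (\<forall>i<k. \<forall>j<k. H $$ (i, j) \<in> {-1, 1}) \<and>
     (\<forall>i<k. \<forall>j<k. i \<noteq> j \<longrightarrow> row H i \<bullet> row H j = 0)"

definition unbiased :: "nat \<Rightarrow> real mat \<Rightarrow> real mat \<Rightarrow> bool" where
  "unbiased k H K \<longleftrightarrow>
     (\<exists>L. hadamard k L \<and> H * transpose_mat K = sqrt (real k) \<cdot>\<^sub>m L)"

definition mutually_unbiased :: "nat \<Rightarrow> real mat set \<Rightarrow> bool" where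
  "mutually_unbiased k S \<longleftrightarrow>
     (\<forall>H\<in>S. hadamard k H) \<and>
     (\<forall>H\<in>S. \<forall>K\<in>S. H \<noteq> K \<longrightarrow> unbiased k H K)"

text \<open>The block in position \<open>(i, j)\<close> of a matrix partitioned into blocks of size \<open>b\<close>;
  block positions are counted from 0.\<close>

definition block :: "nat \<Rightarrow> real mat \<Rightarrow> nat \<Rightarrow> nat \<Rightarrow> real mat" where
  "block b H i j = mat b b (\<lambda>(r, c). H $$ (i * b + r, j * b + c))"

definition bush_type_hadamard :: "nat \<Rightarrow> real mat \<Rightarrow> bool" where
  "bush_type_hadamard n H \<longleftrightarrow>
     hadamard (4 * n\<^sup>2) H \<and>
     (\<forall>i<2 * n. block (2 * n) H i i = all_ones_mat (2 * n)) \<and>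
     (\<forall>i<2 * n. \<forall>j<2 * n. i \<noteq> j \<longrightarrow>
        block (2 * n) H i j * all_ones_mat (2 * n) = 0\<^sub>m (2 * n) (2 * n) \<and>
        all_ones_mat (2 * n) * block (2 * n) H i j = 0\<^sub>m (2 * n) (2 * n))"

end

(* Write b = 2n.  For a member H of the set, weight its first b rows by the entries of column b (the
   first column of block (0,1)) and add them up to y_H.  Unbiasedness makes rows r, s < b of distinct
   members have the constant inner product b, because the corresponding diagonal block of the
   Hadamard matrix L is all ones; as the weights sum to zero, the vectors y_H are pairwise orthogonal.
   Each has squared norm b^3 and inner product b^2 with the fixed vector f that is b e_b minus the
   indicator of block 1, where |f|^2 = b(b - 1).  Bessel's inequality gives m <= b - 1. *)
theory Submission
  imports Defs
begin

lemma hadamard_row_inner: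
  assumes "hadamard k H" and "r < k" and "s < k"
  shows "(\<Sum>x<k. H $$ (r, x) * H $$ (s, x)) = (if r = s then real k else 0)"
proof (cases "r = s")
  case True
  have "H $$ (r, x) * H $$ (r, x) = 1" if "x < k" for x
  proof -
    have "H $$ (r, x) \<in> {-1, 1}"
      using assms that by (auto simp: hadamard_def)
    then show ?thesis by auto
  qed
  then show ?thesis using True by simp
next
  case False
  then have "row H r \<bullet> row H s = 0" and "H \<in> carrier_mat k k"
    using assms by (auto simp: hadamard_def)
  with False show ?thesis
    using assms by (simp add: scalar_prod_def atLeast0LessThan)
qed

lemma bush_type_first_block:
  assumes "bush_type_hadamard n H" and "r < 2 * n" and "x < 2 * n"
  shows "H $$ (r, x) = 1"
proof -
  have "block (2 * n) H 0 0 = all_ones_mat (2 * n)"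
    using assms by (auto simp: bush_type_hadamard_def)
  then have "block (2 * n) H 0 0 $$ (r, x) = all_ones_mat (2 * n) $$ (r, x)"
    by simp
  then show ?thesis using assms(2,3) by (simp add: block_def all_ones_mat_def)
qed

text \<open>Column \<open>x\<close> runs through an off-diagonal block of the first block row, and
  each entry of J times that block is one of its column sums.\<close>

lemma bush_type_col_sum:
  assumes "bush_type_hadamard n H" and "2 * n \<le> x" and "x < 4 * n\<^sup>2"
  shows "(\<Sum>r<2 * n. H $$ (r, x)) = 0"
proof -
  let ?b = "2 * n"
  define j c where "j = x div ?b" and "c = x mod ?b"
  have "n > 0" using assms(3) by (cases n) auto
  have c: "c < ?b" using \<open>n > 0\<close> by (simp add: c_def)
  have j: "j < ?b"
    using assms(3) \<open>n > 0\<close> by (simp add: j_def div_less_iff_less_mult power2_eq_square)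
  have "j \<noteq> 0" using assms(2) \<open>n > 0\<close> by (simp add: j_def div_eq_0_iff)
  then have "all_ones_mat ?b * block ?b H 0 j = 0\<^sub>m ?b ?b"
    using assms(1) j by (auto simp: bush_type_hadamard_def)
  then have "(all_ones_mat ?b * block ?b H 0 j) $$ (0, c) = 0\<^sub>m ?b ?b $$ (0, c)"
    by simp
  then have "(\<Sum>r<?b. H $$ (r, j * ?b + c)) = 0"
    using c by (simp add: block_def all_ones_mat_def scalar_prod_def atLeast0LessThan)
  moreover have "j * ?b + c = x" unfolding j_def c_def by (rule div_mult_mod_eq)
  ultimately show ?thesis by simp
qed

lemma bush_type_row_sum:
  assumes "bush_type_hadamard n H" and "r < 2 * n"
  shows "(\<Sum>x\<in>{2 * n..<2 * n + 2 * n}. H $$ (r, x)) = 0"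
proof -
  let ?b = "2 * n"
  have "0 < ?b" and "1 < ?b" using assms(2) by presburger+
  then have "block ?b H 0 1 * all_ones_mat ?b = 0\<^sub>m ?b ?b"
    using assms(1) unfolding bush_type_hadamard_def by (metis zero_neq_one)
  then have "(block ?b H 0 1 * all_ones_mat ?b) $$ (r, 0) = 0\<^sub>m ?b ?b $$ (r, 0)"
    by simp
  then have "(\<Sum>c<?b. H $$ (r, ?b + c)) = 0"
    using assms(2) by (simp add: block_def all_ones_mat_def scalar_prod_def atLeast0LessThan)
  moreover have "(\<Sum>x\<in>{0 + ?b..<?b + ?b}. H $$ (r, x)) = (\<Sum>c\<in>{0..<?b}. H $$ (r, c + ?b))"
    by (rule sum.shift_bounds_nat_ivl)
  ultimately show ?thesis by (simp add: add.commute atLeast0LessThan)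
qed

text \<open>The slacks \<open>1 - f x\<close> are nonnegative with sum zero. This will force a
  segment of a row of L to consist of ones.\<close>

lemma sum_eq_card_imp_eq_one:
  fixes f :: "'a \<Rightarrow> real"
  assumes "finite A" and "\<And>x. x \<in> A \<Longrightarrow> f x \<le> 1" and "sum f A = card A" and "x \<in> A"
  shows "f x = 1"
proof -
  have "(\<Sum>x\<in>A. 1 - f x) = 0" using assms(3) by (simp add: sum_subtractf)
  then have "\<forall>x\<in>A. 1 - f x = 0"
    using assms(1,2) by (subst (asm) sum_nonneg_eq_0_iff) auto
  then show ?thesis using assms(4) by simp
qed

text \<open>The first b entries of row \<open>r\<close> of L are at most 1 and turn out to sum to b,
  so all are 1. Their sum is computable because adding over the rows of \<open>K\<close> brings in
  its column sums, which vanish off the diagonal block.\<close>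

lemma unbiased_bush_type_row_inner:
  assumes H: "bush_type_hadamard n H" and K: "bush_type_hadamard n K"
    and unb: "unbiased (4 * n\<^sup>2) H K" and r: "r < 2 * n" and s: "s < 2 * n"
  shows "(\<Sum>x<4 * n\<^sup>2. H $$ (r, x) * K $$ (s, x)) = real (2 * n)"
proof -
  let ?b = "2 * n" and ?N = "4 * n\<^sup>2"
  have "n > 0" using r by simp
  have bN: "?b \<le> ?N" using \<open>n > 0\<close> by (simp add: power2_eq_square)
  obtain L where L: "hadamard ?N L" and eq: "H * transpose_mat K = sqrt (real ?N) \<cdot>\<^sub>m L"
    using unb by (auto simp: unbiased_def)
  have carr: "H \<in> carrier_mat ?N ?N" "K \<in> carrier_mat ?N ?N" "L \<in> carrier_mat ?N ?N"
    using H K L by (auto simp: bush_type_hadamard_def hadamard_def)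
  \<comment> \<open>The scaling factor in \<open>unbiased\<close> is thus the block size.\<close>
  have sq: "sqrt (real ?N) = real ?b"
    by (rule real_sqrt_unique) (auto simp: power_mult_distrib)
  have inner: "(\<Sum>x<?N. H $$ (r, x) * K $$ (t, x)) = real ?b * L $$ (r, t)" if "t < ?b" for t
  proof -
    have "(H * transpose_mat K) $$ (r, t) = (sqrt (real ?N) \<cdot>\<^sub>m L) $$ (r, t)"
      using eq by simp
    then show ?thesis
      unfolding sq using carr r that bN by (simp add: scalar_prod_def atLeast0LessThan)
  qed
  have "real ?b * (\<Sum>t<?b. L $$ (r, t)) = (\<Sum>t<?b. \<Sum>x<?N. H $$ (r, x) * K $$ (t, x))"
    using inner by (simp add: sum_distrib_left)
  also have "\<dots> = (\<Sum>x<?N. H $$ (r, x) * (\<Sum>t<?b. K $$ (t, x)))"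
    by (subst sum.swap) (simp add: sum_distrib_left)
  \<comment> \<open>In the first b columns \<open>H\<close> is 1 and each column of \<open>K\<close>
    sums to b; in every later column the sum over \<open>K\<close> is 0.\<close>
  also have "\<dots> = (\<Sum>x<?N. if x < ?b then real ?b else 0)"
  proof (rule sum.cong)
    fix x assume "x \<in> {..<?N}"
    then show "H $$ (r, x) * (\<Sum>t<?b. K $$ (t, x)) = (if x < ?b then real ?b else 0)"
      using bush_type_first_block[OF H r] bush_type_first_block[OF K] bush_type_col_sum[OF K]
      by auto
  qed simp
  also have "\<dots> = (\<Sum>x<?b. real ?b)"
    using bN by (intro sum.mono_neutral_cong_right) auto
  \<comment> \<open>The right side is b * b, and one factor b cancels.\<close>
  finally have "(\<Sum>t<?b. L $$ (r, t)) = card {..<?b}" using \<open>n > 0\<close> by simp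
  moreover have "L $$ (r, t) \<le> 1" if "t < ?b" for t
  proof -
    have "L $$ (r, t) \<in> {-1, 1}" using L r that bN by (auto simp: hadamard_def)
    then show ?thesis by auto
  qed
  ultimately have "L $$ (r, s) = 1"
    using s by (intro sum_eq_card_imp_eq_one[of "{..<?b}" "\<lambda>t. L $$ (r, t)"]) auto
  then show ?thesis using inner[OF s] by simp
qed

text \<open>For a Hadamard matrix of order k > b this is k times the orthogonal projection of the
  unit vector e_b onto the span of the first b rows.\<close>

definition weighted_row_sum :: "nat \<Rightarrow> real mat \<Rightarrow> nat \<Rightarrow> real" where
  "weighted_row_sum b H x = (\<Sum>r<b. H $$ (r, b) * H $$ (r, x))"

text \<open>One expansion for two uses: distinct matrices give orthogonality, \<open>K = H\<close>
  gives the norm.\<close>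

lemma weighted_row_sum_inner:
  "(\<Sum>x<N. weighted_row_sum b H x * weighted_row_sum b K x) =
    (\<Sum>r<b. \<Sum>s<b. H $$ (r, b) * K $$ (s, b) * (\<Sum>x<N. H $$ (r, x) * K $$ (s, x)))"
proof -
  have "(\<Sum>x<N. weighted_row_sum b H x * weighted_row_sum b K x) =
      (\<Sum>x<N. \<Sum>r<b. \<Sum>s<b. H $$ (r, b) * K $$ (s, b) * (H $$ (r, x) * K $$ (s, x)))"
    by (simp add: weighted_row_sum_def sum_product mult_ac)
  also have "\<dots> = (\<Sum>r<b. \<Sum>x<N. \<Sum>s<b. H $$ (r, b) * K $$ (s, b) * (H $$ (r, x) * K $$ (s, x)))"
    by (rule sum.swap)
  also have "\<dots> = (\<Sum>r<b. \<Sum>s<b. \<Sum>x<N. H $$ (r, b) * K $$ (s, b) * (H $$ (r, x) * K $$ (s, x)))"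
    by (intro sum.cong refl sum.swap)
  finally show ?thesis by (simp add: sum_distrib_left)
qed

lemma unbiased_bush_type_weighted_orthogonal:
  assumes H: "bush_type_hadamard n H" and K: "bush_type_hadamard n K"
    and unb: "unbiased (4 * n\<^sup>2) H K" and "n \<ge> 1"
  shows "(\<Sum>x<4 * n\<^sup>2. weighted_row_sum (2 * n) H x * weighted_row_sum (2 * n) K x) = 0"
proof -
  let ?b = "2 * n"
  have "?b < 4 * n\<^sup>2" using \<open>n \<ge> 1\<close> by (simp add: power2_eq_square)
  then have "(\<Sum>r<?b. H $$ (r, ?b)) = 0" by (intro bush_type_col_sum[OF H]) auto
  moreover have "(\<Sum>x<4 * n\<^sup>2. weighted_row_sum ?b H x * weighted_row_sum ?b K x) =
      (\<Sum>r<?b. \<Sum>s<?b. H $$ (r, ?b) * K $$ (s, ?b) * real ?b)"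
    unfolding weighted_row_sum_inner
    by (intro sum.cong refl) (simp add: unbiased_bush_type_row_inner[OF H K unb])
  \<comment> \<open>The row inner product is the same for all \<open>r\<close> and \<open>s\<close>,
    so the double sum factors, and the first factor is zero.\<close>
  moreover have "\<dots> = (\<Sum>r<?b. H $$ (r, ?b)) * (\<Sum>s<?b. K $$ (s, ?b)) * real ?b"
    unfolding sum_product unfolding sum_distrib_right ..
  ultimately show ?thesis by simp
qed

lemma bush_type_entry_square:
  assumes "bush_type_hadamard n H" and "r < 4 * n\<^sup>2" and "x < 4 * n\<^sup>2"
  shows "H $$ (r, x) * H $$ (r, x) = 1"
proof -
  have "H $$ (r, x) \<in> {-1, 1}"
    using assms unfolding bush_type_hadamard_def hadamard_def by blast
  then show ?thesis by auto
qed

lemma weighted_row_sum_base: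
  assumes "bush_type_hadamard n H" and "n \<ge> 1"
  shows "weighted_row_sum (2 * n) H (2 * n) = real (2 * n)"
proof -
  have "2 * n < 4 * n\<^sup>2" using assms(2) by (simp add: power2_eq_square)
  then show ?thesis
    using bush_type_entry_square[OF assms(1)] by (simp add: weighted_row_sum_def)
qed

text \<open>Only the terms with \<open>r = s\<close> survive, and each of these b terms equals the
  order, b^2.\<close>

lemma weighted_row_sum_norm:
  assumes "bush_type_hadamard n H" and "n \<ge> 1"
  shows "(\<Sum>x<4 * n\<^sup>2. weighted_row_sum (2 * n) H x * weighted_row_sum (2 * n) H x)
    = real (2 * n) ^ 3"
proof -
  let ?b = "2 * n" and ?N = "4 * n\<^sup>2"
  have bN: "?b < ?N" using assms(2) by (simp add: power2_eq_square)
  have had: "hadamard ?N H" using assms(1) by (simp add: bush_type_hadamard_def)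
  have "(\<Sum>x<?N. weighted_row_sum ?b H x * weighted_row_sum ?b H x) =
      (\<Sum>r<?b. \<Sum>s<?b. if r = s then H $$ (r, ?b) * H $$ (r, ?b) * real ?N else 0)"
    unfolding weighted_row_sum_inner
    using bN by (intro sum.cong refl) (simp add: hadamard_row_inner[OF had])
  also have "\<dots> = (\<Sum>r<?b. real ?N)"
    using bush_type_entry_square[OF assms(1)] bN by (simp add: sum.delta)
  also have "\<dots> = real ?b ^ 3" by (simp add: power2_eq_square power3_eq_cube)
  finally show ?thesis .
qed

text \<open>Each row of block (0,1) sums to zero, whatever weight it carries.\<close>

lemma weighted_row_sum_block:
  assumes "bush_type_hadamard n H"
  shows "(\<Sum>x\<in>{2 * n..<2 * n + 2 * n}. weighted_row_sum (2 * n) H x) = 0"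
  unfolding weighted_row_sum_def
  by (subst sum.swap)
    (simp add: sum_distrib_left[symmetric] bush_type_row_sum[OF assms, simplified])

text \<open>The projection of \<open>f\<close> onto the span of the \<open>y i\<close> is
  \<open>q / p\<close> times their sum \<open>Y\<close>, so the bound comes from expanding the
  squared norm of \<open>p * f - q * Y\<close>; scaling by \<open>p\<close> avoids division.\<close>

lemma bessel_equal_products:
  fixes f :: "'a \<Rightarrow> real" and y :: "'i \<Rightarrow> 'a \<Rightarrow> real"
  assumes "finite I" and "p > 0"
    and orth: "\<And>i j. \<lbrakk>i \<in> I; j \<in> I; i \<noteq> j\<rbrakk> \<Longrightarrow> (\<Sum>x\<in>A. y i x * y j x) = 0"
    and norm: "\<And>i. i \<in> I \<Longrightarrow> (\<Sum>x\<in>A. y i x * y i x) = p"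
    and prod: "\<And>i. i \<in> I \<Longrightarrow> (\<Sum>x\<in>A. f x * y i x) = q"
  shows "real (card I) * q\<^sup>2 \<le> p * (\<Sum>x\<in>A. f x * f x)"
proof -
  define Y where "Y x = (\<Sum>i\<in>I. y i x)" for x
  have YY: "(\<Sum>x\<in>A. Y x * Y x) = real (card I) * p"
  proof -
    have "(\<Sum>x\<in>A. Y x * Y x) = (\<Sum>x\<in>A. \<Sum>i\<in>I. \<Sum>j\<in>I. y i x * y j x)"
      by (simp add: Y_def sum_product)
    also have "\<dots> = (\<Sum>i\<in>I. \<Sum>x\<in>A. \<Sum>j\<in>I. y i x * y j x)"
      by (rule sum.swap)
    also have "\<dots> = (\<Sum>i\<in>I. \<Sum>j\<in>I. \<Sum>x\<in>A. y i x * y j x)"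
      by (intro sum.cong refl sum.swap)
    also have "\<dots> = (\<Sum>i\<in>I. \<Sum>j\<in>I. if i = j then p else 0)"
      by (intro sum.cong refl) (auto simp: orth norm)
    finally show ?thesis using \<open>finite I\<close> by (simp add: sum.delta)
  qed
  have fY: "(\<Sum>x\<in>A. f x * Y x) = real (card I) * q"
  proof -
    have "(\<Sum>x\<in>A. f x * Y x) = (\<Sum>i\<in>I. \<Sum>x\<in>A. f x * y i x)"
      unfolding Y_def sum_distrib_left by (rule sum.swap)
    then show ?thesis by (simp add: prod)
  qed
  have "0 \<le> (\<Sum>x\<in>A. (p * f x - q * Y x)\<^sup>2)" by (simp add: sum_nonneg)
  also have "\<dots> = (\<Sum>x\<in>A. p\<^sup>2 * (f x * f x) - 2 * p * q * (f x * Y x) + q\<^sup>2 * (Y x * Y x))"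
    by (intro sum.cong refl) (simp add: power2_eq_square algebra_simps)
  also have "\<dots> = p\<^sup>2 * (\<Sum>x\<in>A. f x * f x) - 2 * p * q * (\<Sum>x\<in>A. f x * Y x)
      + q\<^sup>2 * (\<Sum>x\<in>A. Y x * Y x)"
    by (simp only: sum.distrib sum_subtractf sum_distrib_left)
  \<comment> \<open>The cross term -2 p q^2 |I| and the last term p q^2 |I| combine to -p q^2
    |I|.\<close>
  also have "\<dots> = p * (p * (\<Sum>x\<in>A. f x * f x) - real (card I) * q\<^sup>2)"
    unfolding YY fY by (simp add: power2_eq_square algebra_simps)
  finally show ?thesis using \<open>p > 0\<close> by (simp add: zero_le_mult_iff)
qed

theorem mainTheorem3:
  fixes n m :: nat and S :: "real mat set"
  assumes "n \<ge> 1"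
    and "finite S" and "card S = m"
    and "\<And>H. H \<in> S \<Longrightarrow> bush_type_hadamard n H"
    and "mutually_unbiased (4 * n\<^sup>2) S"
  shows "m \<le> 2 * n - 1"
proof -
  let ?b = "2 * n" and ?N = "4 * n\<^sup>2"
  \<comment> \<open>The vector b e_b alone would give only m \<le> b. Since every y_H sums to zero
    over block 1, subtracting the indicator of that block keeps the inner products at b^2 but lowers
    the squared norm from b^2 to b(b - 1).\<close>
  define f :: "nat \<Rightarrow> real" where
    "f x = (if x = ?b then real ?b else 0) - (if x \<in> {?b..<?b + ?b} then 1 else 0)" for x
  have b: "?b < ?N" using assms(1) by (simp add: power2_eq_square)
  \<comment> \<open>Block 1 must lie within the b^2 columns, which needs 2b \<le> b^2 and follows
    from b \<ge> 2.\<close>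
  have "?b * 2 \<le> ?b * ?b" using assms(1) by (intro mult_le_mono) auto
  then have bb: "?b + ?b \<le> ?N" by (simp add: power2_eq_square)
  \<comment> \<open>To be used with \<open>g\<close> equal to \<open>f\<close> for the norm and to
    each y_H for the inner product.\<close>
  have fg: "(\<Sum>x<?N. f x * g x) = real ?b * g ?b - (\<Sum>x\<in>{?b..<?b + ?b}. g x)"
    for g :: "nat \<Rightarrow> real"
  proof -
    have "(\<Sum>x<?N. f x * g x) = (\<Sum>x<?N. if x = ?b then real ?b * g x else 0)
        - (\<Sum>x<?N. if x \<in> {?b..<?b + ?b} then g x else 0)"
      unfolding f_def sum_subtractf[symmetric] by (intro sum.cong refl) (auto simp: algebra_simps)
    moreover have "(\<Sum>x<?N. if x = ?b then real ?b * g x else 0) = real ?b * g ?b"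
      using b by (simp add: sum.delta)
    moreover have "(\<Sum>x<?N. if x \<in> {?b..<?b + ?b} then g x else 0)
        = (\<Sum>x\<in>{?b..<?b + ?b}. g x)"
      using bb by (intro sum.mono_neutral_cong_right) auto
    ultimately show ?thesis by simp
  qed
  \<comment> \<open>As \<open>f\<close> sums to zero over block 1, its squared norm is b times its
    value at b.\<close>
  have "(\<Sum>x\<in>{?b..<?b + ?b}. f x) = 0"
    unfolding f_def sum_subtractf using assms(1) by (simp add: sum.delta)
  moreover have "f ?b = real ?b - 1" using assms(1) by (simp add: f_def)
  ultimately have ff: "(\<Sum>x<?N. f x * f x) = real ?b * (real ?b - 1)"
    using fg[of f] by simp
  have "real (card S) * ((real ?b)\<^sup>2)\<^sup>2 \<le> real ?b ^ 3 * (\<Sum>x<?N. f x * f x)"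
  proof (rule bessel_equal_products[where y = "weighted_row_sum ?b"])
    show "(\<Sum>x<?N. weighted_row_sum ?b H x * weighted_row_sum ?b K x) = 0"
      if "H \<in> S" "K \<in> S" "H \<noteq> K" for H K
      using that assms(1,4,5)
      by (intro unbiased_bush_type_weighted_orthogonal) (auto simp: mutually_unbiased_def)
    show "(\<Sum>x<?N. weighted_row_sum ?b H x * weighted_row_sum ?b H x) = real ?b ^ 3"
      if "H \<in> S" for H
      using weighted_row_sum_norm[OF assms(4)[OF that] assms(1)] .
    show "(\<Sum>x<?N. f x * weighted_row_sum ?b H x) = (real ?b)\<^sup>2" if "H \<in> S" for H
      unfolding fg weighted_row_sum_base[OF assms(4)[OF that] assms(1)]
        weighted_row_sum_block[OF assms(4)[OF that]]
      by (simp add: power2_eq_square)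
  qed (use assms(1,2) in auto)
  \<comment> \<open>With p = b^3 and q = b^2, both sides carry b^4: q^2 on the left, and on the
    right p times the factor b of the squared norm of \<open>f\<close>.\<close>
  then have "real ?b ^ 4 * real m \<le> real ?b ^ 4 * (real ?b - 1)"
    unfolding ff assms(3) by (simp add: eval_nat_numeral mult_ac)
  then have "real m \<le> real ?b - 1"
    by (rule mult_left_le_imp_le) (use assms(1) in simp)
  then show ?thesis by linarith
qed

end
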